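(* Let $B\in\mathbb{R}^{n\times n}$ be symmetric positive semidefinite, $g_B(x)=\tfrac12x^\top Bx$, and let $X\subset\mathbb{R}^n$ be nonempty and compact. For $m\ge1$ and $a_1,\dots,a_m\in X$, define $$g_m(x)=\max_{1\le i\le m}\{g_B(a_i)+\langle Ba_i,x-a_i\rangle\}.$$ Then $$\sup_{x\in X}\bigl(g_B(x)-g_m(x)\bigr)=\frac12\sup_{x\in X}\min_{1\le i\le m}\|B^{1/2}(x-a_i)\|^2 .$$ Consequently, for every $\epsilon>0$, the minimum number $m$ of tangent supports (with support points $a_1,\dots,a_m\in X$) needed for uniform error $\sup_{x\in X}(g_B(x)-g_m(x))\le\epsilon$ is exactly $\mathcal{N}(B^{1/2}X,\sqrt{2\epsilon})$.
   Context: For a compact set $S$ in a Euclidean space and $r>0$, the internal covering number is $$\mathcal{N}(S,r)=\min\Bigl\{m:\exists\, s_1,\dots,s_m\in S,\ S\subset\bigcup_{i=1}^m(s_i+r\mathbb{B})\Bigr\},$$ where $\mathbb{B}$ is the closed Euclidean unit ball. $B^{1/2}$ is the positive semidefinite square root of $B$. *)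

theory Defs
  imports "HOL-Analysis.Analysis"
begin

definition pos_semidef :: "real^'n^'n \<Rightarrow> bool" where
  "pos_semidef B \<longleftrightarrow> transpose B = B \<and> (\<forall>x. 0 \<le> x \<bullet> (B *v x))"

(* Meaningful only for pos_semidef B, where the square root exists and is unique. *)
definition psd_sqrt :: "real^'n^'n \<Rightarrow> real^'n^'n" where
  "psd_sqrt B = (THE S. pos_semidef S \<and> S ** S = B)"

definition quad_form :: "real^'n^'n \<Rightarrow> real^'n \<Rightarrow> real" where
  "quad_form B x = 1/2 * (x \<bullet> (B *v x))"

(* Used for m \<ge> 1 only: Max is unspecified on the empty set. *)
definition tangent_max :: "real^'n^'n \<Rightarrow> nat \<Rightarrow> (nat \<Rightarrow> real^'n) \<Rightarrow> real^'n \<Rightarrow> real" where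
  "tangent_max B m a x = (MAX i\<in>{1..m}. quad_form B (a i) + (B *v a i) \<bullet> (x - a i))"

(* The centres lie in S (internal covering). For compact S and r > 0 a finite cover exists,
   so the least m is attained. *)
definition internal_covering_number :: "'a::euclidean_space set \<Rightarrow> real \<Rightarrow> nat" where
  "internal_covering_number S r =
    (LEAST m. \<exists>s::nat \<Rightarrow> 'a. (\<forall>i\<in>{1..m}. s i \<in> S) \<and> S \<subseteq> (\<Union>i\<in>{1..m}. cball (s i) r))"

definition tangent_approximable :: "real^'n^'n \<Rightarrow> (real^'n) set \<Rightarrow> real \<Rightarrow> nat \<Rightarrow> bool" where
  "tangent_approximable B X \<epsilon> m \<longleftrightarrow> m \<ge> 1 \<and>
    (\<exists>a. (\<forall>i\<in>{1..m}. a i \<in> X) \<and> (SUP x\<in>X. quad_form B x - tangent_max B m a x) \<le> \<epsilon>)"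

end

theory Submission
  imports Defs
begin

text \<open>
  With \<open>S\<close> the positive semidefinite square root of \<open>B\<close>, completing the square gives
  \<open>g(x) - (g(a) + \<langle>B a, x - a\<rangle>) = \<parallel>S (x - a)\<parallel>\<^sup>2 / 2\<close>. So the error of the tangent
  maximum is half the squared distance from \<open>S x\<close> to the nearest \<open>S a\<^sub>i\<close>, and it is at
  most \<open>\<epsilon>\<close> throughout \<open>X\<close> iff the balls of radius \<open>sqrt (2 * \<epsilon>)\<close> about the \<open>S a\<^sub>i\<close>
  cover \<open>S X\<close>.
  The square root is built by splitting off a top eigenvector and inducting on the
  dimension of the kernel. For uniqueness, if \<open>S\<^sup>2 = T\<^sup>2\<close> and \<open>(S - T) u = \<mu> u\<close>, then
  \<open>0 = \<langle>u, (S\<^sup>2 - T\<^sup>2) u\<rangle> = \<mu> \<langle>u, (S + T) u\<rangle>\<close>,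
  and for a unit vector \<open>u\<close> and \<open>\<mu> > 0\<close> the last factor is \<open>2 \<langle>u, T u\<rangle> + \<mu> > 0\<close>. So \<open>S - T\<close>
  has no positive eigenvalue, and neither has \<open>T - S\<close>.
\<close>

section \<open>Symmetric and positive semidefinite matrices\<close>

lemma symmetric_inner:
  fixes A :: "real^'n^'n"
  assumes "transpose A = A"
  shows "(A *v x) \<bullet> y = x \<bullet> (A *v y)"
  by (metis assms dot_lmul_matrix transpose_matrix_vector)

lemma symmetricI:
  fixes A :: "real^'n^'n"
  assumes "\<And>x y. (A *v x) \<bullet> y = x \<bullet> (A *v y)"
  shows "transpose A = A"
proof -
  have "transpose A *v x = A *v x" for x
  proof (rule vector_eq_rdot[THEN iffD1, rule_format])
    fix y show "(transpose A *v x) \<bullet> y = (A *v x) \<bullet> y"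
      by (metis assms dot_lmul_matrix transpose_matrix_vector)
  qed
  then show ?thesis
    by (simp add: matrix_eq)
qed

lemma pos_semidef_inner:
  "pos_semidef A \<Longrightarrow> (A *v x) \<bullet> y = x \<bullet> (A *v y)"
  by (simp add: pos_semidef_def symmetric_inner)

text \<open>Moving from \<open>x\<close> by \<open>- t *\<^sub>R (A *v x)\<close> changes the form
  by \<open>- 2 * t * p + t\<^sup>2 * q\<close>, which is negative for small \<open>t > 0\<close>
  unless \<open>A *v x\<close> vanishes.\<close>

lemma pos_semidef_null:
  fixes A :: "real^'n^'n"
  assumes A: "pos_semidef A" and null: "x \<bullet> (A *v x) = 0"
  shows "A *v x = 0"
proof (rule ccontr)
  define y where "y = A *v x"
  define p where "p = y \<bullet> y"
  define q where "q = y \<bullet> (A *v y)"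
  \<comment> \<open>Small enough that \<open>t * q \<le> p < 2 * p\<close>; the \<open>+ 1\<close>
    keeps the denominator positive when \<open>q = 0\<close>.\<close>
  define t where "t = p / (q + 1)"
  assume "A *v x \<noteq> 0"
  then have p: "p > 0"
    by (simp add: p_def y_def)
  have q: "q \<ge> 0"
    using A by (simp add: pos_semidef_def q_def)
  have "x \<bullet> (A *v y) = p"
    using pos_semidef_inner[OF A, of x y] by (simp add: p_def y_def)
  then have "(x - t *\<^sub>R y) \<bullet> (A *v (x - t *\<^sub>R y)) = t * (t * q - 2 * p)"
    using null
    by (simp add: matrix_vector_mult_diff_distrib matrix_vector_mult_scaleR inner_diff
        q_def p_def y_def[symmetric] algebra_simps)
  moreover have "0 \<le> (x - t *\<^sub>R y) \<bullet> (A *v (x - t *\<^sub>R y))"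
    using A by (simp add: pos_semidef_def)
  moreover have "t > 0"
    using p q by (simp add: t_def)
  ultimately have "t * q \<ge> 2 * p"
    by (simp add: zero_le_mult_iff)
  moreover have "t * q \<le> p"
    using p q by (simp add: t_def field_simps)
  ultimately show False
    using p by simp
qed

text \<open>The Rayleigh quotient attains its maximum \<mu> on the unit sphere at some
  \<open>u\<close>. Then \<mu> times the identity minus \<open>A\<close> is positive semidefinite
  with form zero at \<open>u\<close>, so it annihilates \<open>u\<close>; no differentiation is
  involved.\<close>

lemma symmetric_top_eigenvector:
  fixes A :: "real^'n^'n"
  assumes A: "transpose A = A"
  obtains u \<mu> where "norm u = 1" "A *v u = \<mu> *\<^sub>R u" "\<And>x. x \<bullet> (A *v x) \<le> \<mu> * (x \<bullet> x)"
proof -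
  have "continuous_on (sphere 0 1) (\<lambda>x. x \<bullet> (A *v x))"
    by (intro continuous_intros)
  moreover have "sphere (0::real^'n) 1 \<noteq> {}"
    by simp
  ultimately obtain u where u: "u \<in> sphere 0 1"
    and max: "\<And>x. x \<in> sphere 0 1 \<Longrightarrow> x \<bullet> (A *v x) \<le> u \<bullet> (A *v u)"
    using continuous_attains_sup[OF compact_sphere, of 0 1 "\<lambda>x. x \<bullet> (A *v x)"] by blast
  define \<mu> where "\<mu> = u \<bullet> (A *v u)"
  have le: "x \<bullet> (A *v x) \<le> \<mu> * (x \<bullet> x)" for x
  proof (cases "x = 0")
    case False
    then have "(inverse (norm x) *\<^sub>R x) \<bullet> (A *v (inverse (norm x) *\<^sub>R x)) \<le> \<mu>"
      unfolding \<mu>_def by (intro max) simp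
    then have "(x \<bullet> (A *v x)) / (norm x)\<^sup>2 \<le> \<mu>"
      by (simp add: matrix_vector_mult_scaleR power2_eq_square divide_inverse mult_ac)
    then show ?thesis
      using False by (simp add: pos_divide_le_eq power2_norm_eq_inner)
  qed simp
  define C where "C = \<mu> *\<^sub>R mat 1 - A"
  have C: "C *v x = \<mu> *\<^sub>R x - A *v x" for x
    by (simp add: C_def matrix_vector_mult_diff_rdistrib scaleR_matrix_vector_assoc[symmetric])
  have "pos_semidef C"
    unfolding pos_semidef_def
    by (intro conjI allI symmetricI)
      (simp_all add: C inner_diff symmetric_inner[OF A] le)
  moreover have "u \<bullet> (C *v u) = 0"
    using u by (simp add: C inner_diff \<mu>_def dot_square_norm)
  ultimately have "C *v u = 0"
    by (rule pos_semidef_null)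
  then have "A *v u = \<mu> *\<^sub>R u"
    by (simp add: C)
  moreover have "norm u = 1"
    using u by simp
  ultimately show thesis
    using le by (intro that)
qed

section \<open>Existence of the square root\<close>

text \<open>For a unit vector \<open>u\<close> this is the orthogonal projection onto the line
  through \<open>u\<close>.\<close>

definition rank_one :: "real^'n \<Rightarrow> real^'n^'n" where
  "rank_one u = (\<chi> i j. u $ i * u $ j)"

lemma rank_one_mult: "rank_one u *v x = (u \<bullet> x) *\<^sub>R u"
  by (simp add: rank_one_def vec_eq_iff matrix_vector_mult_def inner_vec_def sum_distrib_left
      mult_ac)

text \<open>The measure is the rank of \<open>B\<close>. Subtracting
  \<open>\<mu> *\<^sub>R rank_one u\<close> adds \<open>u\<close> to the kernel; a root of the
  remainder is completed by \<open>sqrt \<mu> *\<^sub>R rank_one u\<close>.\<close>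

lemma pos_semidef_sqrt_exists:
  fixes B :: "real^'n^'n"
  assumes "pos_semidef B"
  shows "\<exists>S. pos_semidef S \<and> S ** S = B"
  using assms
proof (induction B rule: measure_induct_rule[where f = "\<lambda>B. CARD('n) - dim {x. B *v x = 0}"])
  case (less B)
  note B = \<open>pos_semidef B\<close>
  show ?case
  proof (cases "B = 0")
    case True
    then show ?thesis
      using B by (intro exI[of _ 0]) simp
  next
    case False
    obtain u \<mu> where u: "norm u = 1" and eig: "B *v u = \<mu> *\<^sub>R u"
      and le: "\<And>x. x \<bullet> (B *v x) \<le> \<mu> * (x \<bullet> x)"
      using symmetric_top_eigenvector B by (metis pos_semidef_def)
    have uu: "u \<bullet> u = 1"
      using u by (simp add: dot_square_norm)
    have "\<mu> \<noteq> 0"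
    proof
      assume "\<mu> = 0"
      then have "B *v x = 0" for x
        using le[of x] B by (intro pos_semidef_null) (auto simp: pos_semidef_def intro: antisym)
      then show False
        using False by (simp add: matrix_eq)
    qed
    moreover have "\<mu> \<ge> 0"
      using B[unfolded pos_semidef_def, THEN conjunct2, THEN spec, of u] by (simp add: eig uu)
    ultimately have \<mu>: "\<mu> > 0"
      by simp
    have uB: "u \<bullet> (B *v x) = \<mu> * (u \<bullet> x)" for x
      using pos_semidef_inner[OF B, of u x] eig by simp
    define B' where "B' = B - \<mu> *\<^sub>R rank_one u"
    have B': "B' *v x = B *v x - (\<mu> * (u \<bullet> x)) *\<^sub>R u" for x
      by (simp add: B'_def matrix_vector_mult_diff_rdistrib scaleR_matrix_vector_assoc[symmetric]
          rank_one_mult)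
    have B'u: "B' *v u = 0"
      by (simp add: B' eig uu)
    have "pos_semidef B'"
      unfolding pos_semidef_def
    proof (intro conjI allI symmetricI)
      show "(B' *v x) \<bullet> y = x \<bullet> (B' *v y)" for x y
        by (simp add: B' inner_diff pos_semidef_inner[OF B] inner_commute[of x u])
      fix x
      \<comment> \<open>The component of \<open>x\<close> orthogonal to the eigenvector
        \<open>u\<close>: the form of \<open>B'\<close> at \<open>x\<close> is that of
        \<open>B\<close> at \<open>y\<close>.\<close>
      define y where "y = x - (u \<bullet> x) *\<^sub>R u"
      have "x \<bullet> (B' *v x) = y \<bullet> (B *v y)"
        by (simp add: y_def B' inner_diff matrix_vector_mult_diff_distrib
            matrix_vector_mult_scaleR eig uB uu inner_commute[of x u])
      then show "0 \<le> x \<bullet> (B' *v x)"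
        using B by (simp add: pos_semidef_def)
    qed
    moreover have "dim {x. B *v x = 0} < dim {x. B' *v x = 0}"
    proof (rule dim_psubset)
      have sub: "subspace {x. A *v x = 0}" for A :: "real^'n^'n"
        by (simp add: linear_subspace_kernel)
      have "{x. B *v x = 0} \<subseteq> {x. B' *v x = 0}"
      proof clarify
        fix x assume "B *v x = 0"
        moreover from this uB[of x] \<mu> have "u \<bullet> x = 0"
          by simp
        ultimately show "B' *v x = 0"
          by (simp add: B')
      qed
      moreover have "B *v u \<noteq> 0"
        using \<mu> u eig by auto
      ultimately show "span {x. B *v x = 0} \<subset> span {x. B' *v x = 0}"
        using B'u by (auto simp: span_eq_iff[THEN iffD2, OF sub])
    qed
    moreover have "dim {x. B' *v x = 0} \<le> CARD('n)"
      using dim_subset_UNIV[of "{x. B' *v x = 0}"] by simp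
    ultimately obtain S' where S': "pos_semidef S'" and sq: "S' ** S' = B'"
      using less.IH[of B'] diff_less_mono2 by auto
    \<comment> \<open>This is the form of \<open>B'\<close> at \<open>u\<close>. Since
      \<open>S'\<close> kills \<open>u\<close> and has range orthogonal to \<open>u\<close>, the
      cross terms in the square of \<open>S\<close> vanish.\<close>
    have "(S' *v u) \<bullet> (S' *v u) = 0"
      using sq B'u by (simp add: pos_semidef_inner[OF S'] matrix_vector_mul_assoc)
    then have S'u: "S' *v u = 0"
      by simp
    have uS': "u \<bullet> (S' *v x) = 0" for x
      using pos_semidef_inner[OF S', of u x] S'u by simp
    define S where "S = S' + sqrt \<mu> *\<^sub>R rank_one u"
    have S: "S *v x = S' *v x + (sqrt \<mu> * (u \<bullet> x)) *\<^sub>R u" for x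
      by (simp add: S_def matrix_vector_mult_add_rdistrib scaleR_matrix_vector_assoc[symmetric]
          rank_one_mult)
    have "pos_semidef S"
      unfolding pos_semidef_def
    proof (intro conjI allI symmetricI)
      show "(S *v x) \<bullet> y = x \<bullet> (S *v y)" for x y
        by (simp add: S inner_add pos_semidef_inner[OF S'] inner_commute[of x u])
      show "0 \<le> x \<bullet> (S *v x)" for x
        using S' \<mu> by (simp add: S inner_add pos_semidef_def inner_commute[of x u] mult.assoc)
    qed
    moreover have "S ** S = B"
    proof -
      have "S *v (S *v x) = B *v x" for x
      proof -
        have "S' *v (S' *v x) = B *v x - (\<mu> * (u \<bullet> x)) *\<^sub>R u"
          by (simp add: matrix_vector_mul_assoc sq B')
        then show ?thesis
          using \<mu> by (simp add: S matrix_vector_right_distrib matrix_vector_mult_scaleR S'u uS'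
              inner_add uu)
      qed
      then show ?thesis
        by (simp add: matrix_eq matrix_vector_mul_assoc)
    qed
    ultimately show ?thesis
      by blast
  qed
qed

section \<open>Uniqueness of the square root\<close>

lemma pos_semidef_sqrt_quad_form_le:
  fixes S T :: "real^'n^'n"
  assumes S: "pos_semidef S" and T: "pos_semidef T" and eq: "S ** S = T ** T"
  shows "x \<bullet> (S *v x) \<le> x \<bullet> (T *v x)"
proof -
  have D: "(S - T) *v x = S *v x - T *v x" for x
    by (simp add: matrix_vector_mult_diff_rdistrib)
  have "transpose (S - T) = S - T"
    by (intro symmetricI) (simp add: D inner_diff pos_semidef_inner[OF S] pos_semidef_inner[OF T])
  then obtain u \<mu> where u: "norm u = 1" and eig: "(S - T) *v u = \<mu> *\<^sub>R u"
    and le: "\<And>x. x \<bullet> ((S - T) *v x) \<le> \<mu> * (x \<bullet> x)"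
    using symmetric_top_eigenvector by metis
  have "\<mu> \<le> 0"
  proof (rule ccontr)
    assume \<mu>: "\<not> \<mu> \<le> 0"
    have Su: "S *v u = T *v u + \<mu> *\<^sub>R u"
      using eig by (simp add: D algebra_simps)
    have "(S *v u) \<bullet> (S *v u) = (T *v u) \<bullet> (T *v u)"
      by (simp add: pos_semidef_inner[OF S] pos_semidef_inner[OF T] matrix_vector_mul_assoc eq)
    moreover have "(S *v u) \<bullet> (S *v u) = (T *v u) \<bullet> (T *v u) + \<mu> * (2 * (u \<bullet> (T *v u)) + \<mu>)"
      using u by (simp add: Su inner_add inner_commute[of "T *v u" u] norm_eq_1 algebra_simps)
    ultimately have "\<mu> * (2 * (u \<bullet> (T *v u)) + \<mu>) = 0"
      by linarith
    moreover have "u \<bullet> (T *v u) \<ge> 0"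
      using T by (simp add: pos_semidef_def)
    ultimately show False
      using \<mu> by simp
  qed
  then have "\<mu> * (x \<bullet> x) \<le> 0"
    by (simp add: mult_nonpos_nonneg)
  with le[of x] show ?thesis
    by (simp add: D inner_diff)
qed

text \<open>Comparing the forms in both directions makes the form of \<open>S - T\<close> vanish
  identically. Hence \<open>S - T\<close> is itself positive semidefinite, and every vector lies in
  its kernel.\<close>

lemma pos_semidef_sqrt_unique:
  fixes S T :: "real^'n^'n"
  assumes S: "pos_semidef S" and T: "pos_semidef T" and eq: "S ** S = T ** T"
  shows "S = T"
proof -
  have D: "(S - T) *v x = S *v x - T *v x" for x
    by (simp add: matrix_vector_mult_diff_rdistrib)
  have null: "x \<bullet> ((S - T) *v x) = 0" for x
    using pos_semidef_sqrt_quad_form_le[OF S T eq, of x]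
      pos_semidef_sqrt_quad_form_le[OF T S eq[symmetric], of x]
    by (simp add: D inner_diff)
  then have "pos_semidef (S - T)"
    unfolding pos_semidef_def
    by (intro conjI symmetricI)
      (simp_all add: D inner_diff pos_semidef_inner[OF S] pos_semidef_inner[OF T])
  then have "(S - T) *v x = 0" for x
    using null by (rule pos_semidef_null)
  then show ?thesis
    by (simp add: D matrix_eq)
qed

lemma psd_sqrt:
  fixes B :: "real^'n^'n"
  assumes "pos_semidef B"
  shows pos_semidef_psd_sqrt: "pos_semidef (psd_sqrt B)"
    and psd_sqrt_square: "psd_sqrt B ** psd_sqrt B = B"
proof -
  have "\<exists>!S. pos_semidef S \<and> S ** S = B"
    using pos_semidef_sqrt_exists[OF assms] pos_semidef_sqrt_unique by metis
  from theI'[OF this] show "pos_semidef (psd_sqrt B)" "psd_sqrt B ** psd_sqrt B = B"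
    by (auto simp: psd_sqrt_def)
qed

section \<open>The error of the tangent maximum\<close>

lemma norm_psd_sqrt_mult:
  fixes B :: "real^'n^'n"
  assumes "pos_semidef B"
  shows "(norm (psd_sqrt B *v x))\<^sup>2 = x \<bullet> (B *v x)"
  by (simp add: power2_norm_eq_inner pos_semidef_inner[OF pos_semidef_psd_sqrt[OF assms]]
      matrix_vector_mul_assoc psd_sqrt_square[OF assms])

text \<open>Completing the square. Solving for the tangent lets the equation rewrite each term
  inside \<open>tangent_max\<close>.\<close>

lemma tangent_gap:
  fixes B :: "real^'n^'n"
  assumes B: "pos_semidef B"
  shows "quad_form B a + (B *v a) \<bullet> (x - a)
    = quad_form B x - 1/2 * (norm (psd_sqrt B *v (x - a)))\<^sup>2"
proof -
  have "a \<bullet> (B *v x) = x \<bullet> (B *v a)"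
    by (metis B inner_commute pos_semidef_inner)
  then show ?thesis
    unfolding norm_psd_sqrt_mult[OF B] quad_form_def
    by (simp add: matrix_vector_mult_diff_distrib inner_diff pos_semidef_inner[OF B] field_simps)
qed

lemma quad_form_diff_tangent_max:
  fixes B :: "real^'n^'n"
  assumes B: "pos_semidef B" and m: "m \<ge> 1"
  shows "quad_form B x - tangent_max B m a x
    = 1/2 * (MIN i\<in>{1..m}. (norm (psd_sqrt B *v (x - a i)))\<^sup>2)"
proof -
  let ?f = "\<lambda>i. (norm (psd_sqrt B *v (x - a i)))\<^sup>2"
  \<comment> \<open>A nearest support point \<open>a k\<close> gives the highest tangent at
    \<open>x\<close>.\<close>
  have "Min (?f ` {1..m}) \<in> ?f ` {1..m}"
    using m by (intro Min_in) auto
  then obtain k where k: "k \<in> {1..m}" "Min (?f ` {1..m}) = ?f k"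
    by (rule imageE)
  have "?f k \<le> ?f i" if "i \<in> {1..m}" for i
    unfolding k(2)[symmetric] using that by (intro Min_le) auto
  then have "(MAX i\<in>{1..m}. quad_form B x - 1/2 * ?f i) = quad_form B x - 1/2 * ?f k"
    using k(1) by (intro Max_eqI) auto
  then have "(MAX i\<in>{1..m}. quad_form B x - 1/2 * ?f i) = quad_form B x - 1/2 * Min (?f ` {1..m})"
    unfolding k(2) .
  then show ?thesis
    by (simp add: tangent_max_def tangent_gap[OF B])
qed

text \<open>The minimum is at most the term for index 1, which is continuous on the compact
  \<open>X\<close>. Real suprema can be manipulated only once such a bound is known.\<close>

lemma bdd_above_MIN_norm:
  fixes A :: "real^'n^'n" and X :: "(real^'n) set"
  assumes X: "compact X" and m: "m \<ge> 1"
  shows "bdd_above ((\<lambda>x. MIN i\<in>{1..m::nat}. (norm (A *v (x - a i)))\<^sup>2) ` X)"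
proof -
  have "compact ((\<lambda>x. (norm (A *v (x - a 1)))\<^sup>2) ` X)"
    by (intro compact_continuous_image continuous_intros X
        bounded_linear.continuous_on[OF matrix_vector_mul_bounded_linear])
  then have "bdd_above ((\<lambda>x. (norm (A *v (x - a 1)))\<^sup>2) ` X)"
    by (intro bounded_imp_bdd_above compact_imp_bounded)
  then obtain K where K: "\<And>x. x \<in> X \<Longrightarrow> (norm (A *v (x - a 1)))\<^sup>2 \<le> K"
    unfolding bdd_above_def by blast
  show ?thesis
  proof (rule bdd_aboveI2)
    fix x assume "x \<in> X"
    have "(MIN i\<in>{1..m}. (norm (A *v (x - a i)))\<^sup>2) \<le> (norm (A *v (x - a 1)))\<^sup>2"
      using m by (intro Min_le) auto
    also have "\<dots> \<le> K"
      using K \<open>x \<in> X\<close> by blast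
    finally show "(MIN i\<in>{1..m}. (norm (A *v (x - a i)))\<^sup>2) \<le> K" .
  qed
qed

lemma cSUP_mult_left:
  fixes f :: "'a \<Rightarrow> real"
  assumes "c > 0" and "X \<noteq> {}" and "bdd_above (f ` X)"
  shows "(SUP x\<in>X. c * f x) = c * (SUP x\<in>X. f x)"
proof -
  have "mono ((*) c)"
    using assms(1) by (simp add: mono_def)
  then have "c * Sup (f ` X) = (SUP y\<in>f ` X. c * y)"
    using assms by (intro continuous_at_Sup_mono continuous_intros) auto
  then show ?thesis
    by (simp add: image_image)
qed

lemma SUP_tangent_gap:
  fixes B :: "real^'n^'n" and X :: "(real^'n) set"
  assumes "pos_semidef B" and "X \<noteq> {}" and "compact X" and "m \<ge> 1"
  shows "(SUP x\<in>X. quad_form B x - tangent_max B m a x)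
    = 1/2 * (SUP x\<in>X. MIN i\<in>{1..m}. (norm (psd_sqrt B *v (x - a i)))\<^sup>2)"
  unfolding quad_form_diff_tangent_max[OF assms(1,4)]
  by (rule cSUP_mult_left[OF _ assms(2) bdd_above_MIN_norm[OF assms(3,4)]]) simp

section \<open>Uniform error and coverings\<close>

text \<open>The bound on the supremum holds pointwise, and a finite minimum is at most
  \<open>2 * \<epsilon>\<close> iff some term is, which is membership in the corresponding
  ball.\<close>

lemma SUP_tangent_gap_le_iff:
  fixes B :: "real^'n^'n" and X :: "(real^'n) set"
  assumes B: "pos_semidef B" and X: "X \<noteq> {}" "compact X" and m: "m \<ge> 1" and \<epsilon>: "\<epsilon> > 0"
  shows "(SUP x\<in>X. quad_form B x - tangent_max B m a x) \<le> \<epsilon>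
    \<longleftrightarrow> (\<lambda>x. psd_sqrt B *v x) ` X \<subseteq> (\<Union>i\<in>{1..m}. cball (psd_sqrt B *v a i) (sqrt (2 * \<epsilon>)))"
proof -
  have ball: "(norm (psd_sqrt B *v (x - a i)))\<^sup>2 \<le> 2 * \<epsilon>
      \<longleftrightarrow> psd_sqrt B *v x \<in> cball (psd_sqrt B *v a i) (sqrt (2 * \<epsilon>))" for x i
  proof -
    have "(norm (psd_sqrt B *v (x - a i)))\<^sup>2 \<le> 2 * \<epsilon>
      \<longleftrightarrow> norm (psd_sqrt B *v (x - a i)) \<le> sqrt (2 * \<epsilon>)"
      using \<epsilon> by (metis norm_ge_zero real_sqrt_abs real_sqrt_le_iff abs_norm_cancel)
    then show ?thesis
      by (simp add: matrix_vector_mult_diff_distrib dist_norm norm_minus_commute)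
  qed
  have "(SUP x\<in>X. quad_form B x - tangent_max B m a x) \<le> \<epsilon>
    \<longleftrightarrow> (SUP x\<in>X. MIN i\<in>{1..m}. (norm (psd_sqrt B *v (x - a i)))\<^sup>2) \<le> 2 * \<epsilon>"
    unfolding SUP_tangent_gap[OF B X m] by linarith
  also have "\<dots> \<longleftrightarrow> (\<forall>x\<in>X. (MIN i\<in>{1..m}. (norm (psd_sqrt B *v (x - a i)))\<^sup>2) \<le> 2 * \<epsilon>)"
    using X m by (intro cSUP_le_iff bdd_above_MIN_norm) auto
  also have "\<dots> \<longleftrightarrow> (\<forall>x\<in>X. \<exists>i\<in>{1..m}. (norm (psd_sqrt B *v (x - a i)))\<^sup>2 \<le> 2 * \<epsilon>)"
    using m by (simp add: Min_le_iff)
  also have "\<dots> \<longleftrightarrow> (\<lambda>x. psd_sqrt B *v x) ` X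
      \<subseteq> (\<Union>i\<in>{1..m}. cball (psd_sqrt B *v a i) (sqrt (2 * \<epsilon>)))"
    unfolding ball by blast
  finally show ?thesis .
qed

lemma tangent_approximable_iff_cover:
  fixes B :: "real^'n^'n" and X :: "(real^'n) set"
  assumes B: "pos_semidef B" and X: "X \<noteq> {}" "compact X" and \<epsilon>: "\<epsilon> > 0"
  defines "Y \<equiv> (\<lambda>x. psd_sqrt B *v x) ` X"
  shows "tangent_approximable B X \<epsilon> m
    \<longleftrightarrow> (\<exists>s::nat \<Rightarrow> real^'n. (\<forall>i\<in>{1..m}. s i \<in> Y) \<and> Y \<subseteq> (\<Union>i\<in>{1..m}. cball (s i) (sqrt (2 * \<epsilon>))))"
    (is "_ \<longleftrightarrow> ?cover")
proof
  assume "tangent_approximable B X \<epsilon> m"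
  then obtain a where "m \<ge> 1" "\<forall>i\<in>{1..m}. a i \<in> X"
    and "(SUP x\<in>X. quad_form B x - tangent_max B m a x) \<le> \<epsilon>"
    by (auto simp: tangent_approximable_def)
  then show ?cover
    using SUP_tangent_gap_le_iff[OF B X _ \<epsilon>]
    by (intro exI[of _ "\<lambda>i. psd_sqrt B *v a i"]) (auto simp: Y_def)
next
  assume ?cover
  then obtain s :: "nat \<Rightarrow> real^'n" where s: "\<forall>i\<in>{1..m}. s i \<in> Y"
    and cover: "Y \<subseteq> (\<Union>i\<in>{1..m}. cball (s i) (sqrt (2 * \<epsilon>)))"
    by blast
  \<comment> \<open>An empty union cannot cover the nonempty \<open>Y\<close>, so allowing
    \<open>m = 0\<close> in the covering number does no harm.\<close>
  have m: "m \<ge> 1"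
    using cover X by (cases m) (auto simp: Y_def)
  \<comment> \<open>Centres in the image pull back to support points in \<open>X\<close>. Any
    preimage will do, since the criterion sees only \<open>psd_sqrt B *v a i\<close>.\<close>
  from s have "\<forall>i\<in>{1..m}. \<exists>x. x \<in> X \<and> s i = psd_sqrt B *v x"
    by (auto simp: Y_def)
  then obtain a where a: "\<forall>i\<in>{1..m}. a i \<in> X \<and> s i = psd_sqrt B *v a i"
    by metis
  with cover have "Y \<subseteq> (\<Union>i\<in>{1..m}. cball (psd_sqrt B *v a i) (sqrt (2 * \<epsilon>)))"
    by auto
  then show "tangent_approximable B X \<epsilon> m"
    using a m SUP_tangent_gap_le_iff[OF B X m \<epsilon>]
    by (auto simp: tangent_approximable_def Y_def)
qed

text \<open>Total boundedness provides finitely many centres inside \<open>Y\<close>, which are then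
  numbered from 1. This makes the minimum a genuine one.\<close>

lemma compact_finite_internal_cover:
  fixes Y :: "'a::euclidean_space set"
  assumes "compact Y" and "r > 0"
  shows "\<exists>(m::nat) s. (\<forall>i\<in>{1..m}. s i \<in> Y) \<and> Y \<subseteq> (\<Union>i\<in>{1..m}. cball (s i) r)"
proof -
  have "\<exists>k. finite k \<and> k \<subseteq> Y \<and> Y \<subseteq> (\<Union>x\<in>k. ball x r)"
    using assms by (intro seq_compact_imp_totally_bounded[rule_format] compact_imp_seq_compact)
  then obtain k where k: "finite k" "k \<subseteq> Y" "Y \<subseteq> (\<Union>x\<in>k. ball x r)"
    by blast
  obtain h where "bij_betw h {1..card k} k"
    using ex_bij_betw_nat_finite_1[OF k(1)] by blast
  then have h: "h ` {1..card k} = k"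
    by (simp add: bij_betw_def)
  have "Y \<subseteq> (\<Union>x\<in>k. cball x r)"
    using k(3) by (rule order_trans) (intro UN_mono order_refl ball_subset_cball)
  also have "\<dots> = (\<Union>i\<in>{1..card k}. cball (h i) r)"
    by (subst h[symmetric]) (simp only: image_image)
  finally have "Y \<subseteq> (\<Union>i\<in>{1..card k}. cball (h i) r)" .
  moreover have "\<forall>i\<in>{1..card k}. h i \<in> Y"
    using h k(2) by blast
  ultimately show ?thesis
    by blast
qed

theorem theorem8p1:
  fixes B :: "real^'n^'n" and X :: "(real^'n) set"
  assumes "pos_semidef B" and "X \<noteq> {}" and "compact X"
  shows "(\<forall>(m::nat) a. m \<ge> 1 \<longrightarrow> (\<forall>i\<in>{1..m}. a i \<in> X) \<longrightarrow>
            (SUP x\<in>X. quad_form B x - tangent_max B m a x)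
            = 1/2 * (SUP x\<in>X. MIN i\<in>{1..m}. (norm (psd_sqrt B *v (x - a i)))\<^sup>2)) \<and>
         (\<forall>\<epsilon>>0. (\<exists>m. tangent_approximable B X \<epsilon> m) \<and>
            (LEAST m. tangent_approximable B X \<epsilon> m)
            = internal_covering_number ((\<lambda>x. psd_sqrt B *v x) ` X) (sqrt (2 * \<epsilon>)))"
proof (intro conjI allI impI)
  show "(SUP x\<in>X. quad_form B x - tangent_max B m a x)
      = 1/2 * (SUP x\<in>X. MIN i\<in>{1..m}. (norm (psd_sqrt B *v (x - a i)))\<^sup>2)"
    if "m \<ge> 1" for m :: nat and a
    using SUP_tangent_gap[OF assms that] .
next
  fix \<epsilon> :: real
  assume \<epsilon>: "\<epsilon> > 0"
  have "compact ((\<lambda>x. psd_sqrt B *v x) ` X)"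
    by (intro compact_continuous_image continuous_intros assms(3))
  then show "\<exists>m. tangent_approximable B X \<epsilon> m"
    unfolding tangent_approximable_iff_cover[OF assms \<epsilon>]
    using \<epsilon> by (intro compact_finite_internal_cover) auto
  show "(LEAST m. tangent_approximable B X \<epsilon> m)
      = internal_covering_number ((\<lambda>x. psd_sqrt B *v x) ` X) (sqrt (2 * \<epsilon>))"
    \<comment> \<open>The two predicates agree for every \<open>m\<close>, so both sides become the
      same \<open>LEAST\<close> term.\<close>
    unfolding internal_covering_number_def tangent_approximable_iff_cover[OF assms \<epsilon>] ..
qed

end
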